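(* Let $\Omega\subset\mathbb{C}$ be an open set, let $p$ be a subharmonic function in $\Omega$ satisfying the standing assumptions (1) and (2) stated in the context, let $n\ge 1$ be an integer, and let $f\in\mathsf{A}^n_p(\Omega)$, i.e. $f$ is a polyanalytic function of order $n$ on $\Omega$ such that for every $k=0,1,\dots,n-1$ $$\int_{\Omega}|\overline{\partial}^{k}f(z)|^2e^{-p(z)}\,d\lambda(z)<+\infty.$$ Then the function $$u(z,\overline{z}):=-\sum_{k=1}^n\frac{(-1)^k}{k!}\,\overline{z}^k\,\overline{\partial}^{k-1}f(z),\qquad z\in\Omega,$$ is a solution of $\overline{\partial}u=f$ on $\Omega$. Moreover, the following estimate holds: $$\int_{\Omega}\frac{|u(z,\overline{z})|^2}{(1+|z|^2)^{2n}}e^{-p(z)}\,d\lambda(z)\le n\sum_{k=1}^n\int_{\Omega}|\overline{\partial}^{k-1}f(z)|^2e^{-p(z)}\,d\lambda(z)<+\infty.$$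
   Context: Notation: $\overline{\partial}=\frac{\partial}{\partial\overline z}=\frac12\left(\frac{\partial}{\partial x}+i\frac{\partial}{\partial y}\right)$ for $z=x+iy$, and $\overline{\partial}^k$ is its $k$-th power ($\overline{\partial}^0$ is the identity); $d\lambda$ is Lebesgue measure on $\mathbb{C}$. Standing assumptions on $p$: (1) $p(z)\ge 0$ and $\log(1+|z|^2)=O(p(z))$, i.e. there is $M>0$ with $\log(1+|z|^2)\le M p(z)$ for all $z$; (2) there exist constants $C,D>0$ such that $|z-w|\le 1$ implies $p(z)\le Cp(w)+D$. A function of class $\mathcal{C}^n$ on $\Omega$ is polyanalytic of order $n$ if $\overline{\partial}^n f=0$ on $\Omega$. *)

theory Defs
  imports "HOL-Analysis.Analysis"
begin

text \<open>
  Real partial derivatives in \<open>z = x + \<i>y\<close>. As \<open>vector_derivative\<close> is total, their values only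
  mean something where the one-variable functions are differentiable; \<open>class_C\<close> records this.
\<close>

definition partial_x :: "(complex \<Rightarrow> complex) \<Rightarrow> complex \<Rightarrow> complex" where
  "partial_x f z = vector_derivative (\<lambda>t::real. f (z + of_real t)) (at 0)"

definition partial_y :: "(complex \<Rightarrow> complex) \<Rightarrow> complex \<Rightarrow> complex" where
  "partial_y f z = vector_derivative (\<lambda>t::real. f (z + \<i> * of_real t)) (at 0)"

definition dbar :: "(complex \<Rightarrow> complex) \<Rightarrow> complex \<Rightarrow> complex" where
  "dbar f z = (1 / 2) * (partial_x f z + \<i> * partial_y f z)"

text \<open>
  Real differentiability class \<open>C\<^sup>n\<close>, meant for open \<open>\<Omega>\<close>: all partial derivatives
  of order at most \<open>n\<close> exist and are continuous on \<open>\<Omega>\<close>.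
\<close>

fun class_C :: "nat \<Rightarrow> complex set \<Rightarrow> (complex \<Rightarrow> complex) \<Rightarrow> bool" where
  "class_C 0 \<Omega> f \<longleftrightarrow> continuous_on \<Omega> f"
| "class_C (Suc n) \<Omega> f \<longleftrightarrow>
     continuous_on \<Omega> f \<and>
     (\<forall>z\<in>\<Omega>. (\<lambda>t::real. f (z + of_real t)) differentiable (at 0) \<and>
             (\<lambda>t::real. f (z + \<i> * of_real t)) differentiable (at 0)) \<and>
     class_C n \<Omega> (partial_x f) \<and> class_C n \<Omega> (partial_y f)"

definition polyanalytic_on :: "nat \<Rightarrow> complex set \<Rightarrow> (complex \<Rightarrow> complex) \<Rightarrow> bool" where
  "polyanalytic_on n \<Omega> f \<longleftrightarrow> class_C n \<Omega> f \<and> (\<forall>z\<in>\<Omega>. (dbar ^^ n) f z = 0)"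

text \<open>
  Subharmonicity on open \<open>\<Omega>\<close> of a function that never takes the value \<open>-\<infinity>\<close>: upper
  semicontinuity together with the sub-mean value inequality on all closed discs in \<open>\<Omega>\<close>.
  An upper semicontinuous function is bounded above on circles, so its circular mean exists in
  \<open>[-\<infinity>, \<infinity>)\<close>; as \<open>p z\<close> is finite, the inequality forces the mean to be finite. The
  integrability conjunct says just this, and keeps the default value 0 of a divergent Bochner
  integral from playing a role.
\<close>

definition subharmonic_on :: "complex set \<Rightarrow> (complex \<Rightarrow> real) \<Rightarrow> bool" where
  "subharmonic_on \<Omega> p \<longleftrightarrow>
     (\<forall>z\<in>\<Omega>. \<forall>a. p z < a \<longrightarrow> eventually (\<lambda>w. p w < a) (at z within \<Omega>)) \<and>
     (\<forall>z r. 0 < r \<longrightarrow> cball z r \<subseteq> \<Omega> \<longrightarrow>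
        set_integrable lborel {0..2 * pi} (\<lambda>t. p (z + of_real r * cis t)) \<and>
        p z \<le> 1 / (2 * pi) * (LBINT t:{0..2 * pi}. p (z + of_real r * cis t)))"

definition weighted_polyanalytic :: "nat \<Rightarrow> (complex \<Rightarrow> real) \<Rightarrow> complex set \<Rightarrow> (complex \<Rightarrow> complex) set"
  where
  "weighted_polyanalytic n p \<Omega> = {f. polyanalytic_on n \<Omega> f \<and>
     (\<forall>k<n. (\<integral>\<^sup>+z\<in>\<Omega>. ennreal ((cmod ((dbar ^^ k) f z))\<^sup>2 * exp (- p z)) \<partial>lebesgue) < \<infinity>)}"

end

(* Since dbar (cnj z ^ k / k!) = cnj z ^ (k - 1) / (k - 1)!, applying dbar to the sum defining u
   telescopes: only the term f survives, because dbar^n f = 0. The estimate is Cauchy-Schwarz for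
   a sum of n terms together with |z| ^ (2 k) <= (1 + |z|^2) ^ (2 n); upper semicontinuity
   of p makes the integrands measurable, so that sum and integral may be exchanged. *)
theory Submission
  imports Defs
begin

section \<open>Directional derivatives and the classes \<open>class_C\<close>\<close>

definition directional :: "complex \<Rightarrow> (complex \<Rightarrow> complex) \<Rightarrow> complex \<Rightarrow> complex" where
  "directional d f z = vector_derivative (\<lambda>t::real. f (z + d * of_real t)) (at 0)"

text \<open>Both partial derivatives become instances of one notion, so every rule below is proved
  once for \<open>d \<in> {1, \<i>}\<close> instead of twice.\<close>

lemma partial_x_directional: "partial_x = directional 1"
  by (simp add: fun_eq_iff partial_x_def directional_def)

lemma partial_y_directional: "partial_y = directional \<i>"
  by (simp add: fun_eq_iff partial_y_def directional_def)

lemma dbar_directional: "dbar f z = 1 / 2 * (directional 1 f z + \<i> * directional \<i> f z)"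
  by (simp add: dbar_def partial_x_directional partial_y_directional)

text \<open>\<open>directional\<close> is total and has meaningless values where the derivative does
  not exist. This relation includes existence, so the calculus rules are stated for it and equations
  are read off afterwards.\<close>

definition has_directional :: "(complex \<Rightarrow> complex) \<Rightarrow> complex \<Rightarrow> complex \<Rightarrow> complex \<Rightarrow> bool" where
  "has_directional f D d z \<longleftrightarrow> ((\<lambda>t::real. f (z + d * of_real t)) has_vector_derivative D) (at 0)"

lemma has_directional_imp_eq: "has_directional f D d z \<Longrightarrow> directional d f z = D"
  by (simp add: has_directional_def directional_def vector_derivative_at)

lemma class_C_Suc_iff:
  "class_C (Suc n) \<Omega> f \<longleftrightarrow> continuous_on \<Omega> f \<and>
     (\<forall>d\<in>{1, \<i>}. (\<forall>z\<in>\<Omega>. has_directional f (directional d f z) d z) \<and> class_C n \<Omega> (directional d f))"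
proof -
  have *: "(\<lambda>t::real. f (z + d * of_real t)) differentiable (at 0) \<longleftrightarrow>
      has_directional f (directional d f z) d z" for d z
    unfolding has_directional_def directional_def
    by (metis vector_derivative_works)
  show ?thesis
    by (auto simp: partial_x_directional partial_y_directional simp flip: *)
qed

lemma class_C_has_directional:
  "class_C (Suc n) \<Omega> f \<Longrightarrow> z \<in> \<Omega> \<Longrightarrow> d \<in> {1, \<i>} \<Longrightarrow>
     has_directional f (directional d f z) d z"
  using class_C_Suc_iff by blast

lemma class_C_continuous_on: "class_C n \<Omega> f \<Longrightarrow> continuous_on \<Omega> f"
  by (cases n) auto

lemma class_C_SucI:
  assumes "continuous_on \<Omega> f"
    and "\<And>d z. d \<in> {1, \<i>} \<Longrightarrow> z \<in> \<Omega> \<Longrightarrow> has_directional f (f' d z) d z"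
    and "\<And>d. d \<in> {1, \<i>} \<Longrightarrow> class_C n \<Omega> (directional d f)"
  shows "class_C (Suc n) \<Omega> f"
  unfolding class_C_Suc_iff using assms has_directional_imp_eq by metis

text \<open>As \<open>\<Omega>\<close> is open, the parameters \<open>t\<close> with
  \<open>z + d * of_real t\<close> in \<open>\<Omega>\<close> form an open neighbourhood of 0, and a
  derivative at 0 depends only on the values there.\<close>

lemma has_directional_cong:
  assumes "open \<Omega>" "z \<in> \<Omega>" "\<And>w. w \<in> \<Omega> \<Longrightarrow> f w = g w" "has_directional f D d z"
  shows "has_directional g D d z"
proof -
  have "open ((\<lambda>t::real. z + d * of_real t) -` \<Omega>)"
    by (intro open_vimage assms continuous_intros)
  with assms show ?thesis
    unfolding has_directional_def
    by (elim has_vector_derivative_transform_within_open) auto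
qed

text \<open>By locality of the derivative, the directional derivatives of \<open>f\<close> and
  \<open>g\<close> also agree on \<open>\<Omega>\<close>, which lets the induction descend to
  them.\<close>

lemma class_C_cong:
  assumes "open \<Omega>" "class_C n \<Omega> f" "\<And>z. z \<in> \<Omega> \<Longrightarrow> f z = g z"
  shows "class_C n \<Omega> g"
  using assms(2,3)
proof (induction n arbitrary: f g)
  case 0
  then show ?case by (metis class_C.simps(1) continuous_on_cong)
next
  case (Suc n)
  have g: "has_directional g (directional d f z) d z" if "z \<in> \<Omega>" "d \<in> {1, \<i>}" for d z
    by (rule has_directional_cong[OF assms(1) that(1) Suc.prems(2)
          class_C_has_directional[OF Suc.prems(1) that]])
  show ?case
  proof (rule class_C_SucI[where f' = "\<lambda>d. directional d f"])
    show "continuous_on \<Omega> g"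
      using Suc.prems class_C_continuous_on continuous_on_cong by metis
    fix d :: complex assume d: "d \<in> {1, \<i>}"
    show "class_C n \<Omega> (directional d g)"
    proof (rule Suc.IH)
      show "class_C n \<Omega> (directional d f)" using Suc.prems d class_C_Suc_iff by blast
      show "directional d f z = directional d g z" if "z \<in> \<Omega>" for z
        using g[OF that d] has_directional_imp_eq by metis
    qed
  qed (use g in auto)
qed

text \<open>An explicit formula \<open>f' d\<close> is known to equal \<open>directional d f\<close>
  only on \<open>\<Omega>\<close>; \<open>class_C_cong\<close> bridges the gap. This is the
  induction step in the closure proofs below.\<close>

lemma class_C_SucI_derivative:
  assumes "open \<Omega>" "continuous_on \<Omega> f"
    and der: "\<And>d z. d \<in> {1, \<i>} \<Longrightarrow> z \<in> \<Omega> \<Longrightarrow> has_directional f (f' d z) d z"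
    and "\<And>d. d \<in> {1, \<i>} \<Longrightarrow> class_C n \<Omega> (f' d)"
  shows "class_C (Suc n) \<Omega> f"
proof (rule class_C_SucI[OF assms(2) der])
  fix d :: complex assume d: "d \<in> {1, \<i>}"
  show "class_C n \<Omega> (directional d f)"
    by (rule class_C_cong[OF assms(1) assms(4)[OF d]]) (metis has_directional_imp_eq der d)
qed

lemma class_C_SucD: "class_C (Suc n) \<Omega> f \<Longrightarrow> class_C n \<Omega> f"
proof (induction n arbitrary: f)
  case (Suc n)
  then show ?case using class_C_Suc_iff by metis
qed auto

lemma class_C_mono: "m \<le> n \<Longrightarrow> class_C n \<Omega> f \<Longrightarrow> class_C m \<Omega> f"
  by (induction n) (auto simp: le_Suc_eq simp del: class_C.simps dest: class_C_SucD)

section \<open>Differentiation rules and closure of \<open>class_C\<close> under algebraic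
  operations\<close>

lemma has_directional_const: "has_directional (\<lambda>z. c) 0 d z"
  by (simp add: has_directional_def)

lemma has_directional_add:
  "has_directional f F d z \<Longrightarrow> has_directional g G d z \<Longrightarrow>
     has_directional (\<lambda>z. f z + g z) (F + G) d z"
  unfolding has_directional_def by (rule has_vector_derivative_add)

lemma has_directional_mult:
  "has_directional f F d z \<Longrightarrow> has_directional g G d z \<Longrightarrow>
     has_directional (\<lambda>z. f z * g z) (f z * G + F * g z) d z"
  unfolding has_directional_def
  by (drule (1) has_vector_derivative_mult) simp

text \<open>For real \<open>t\<close>, \<open>cnj (z + d * of_real t)\<close> is affine in
  \<open>t\<close> with slope \<open>cnj d\<close>.\<close>

lemma has_directional_cnj: "has_directional cnj (cnj d) d z"
  unfolding has_directional_def
  by (auto intro!: derivative_eq_intros simp: has_vector_derivative_def scaleR_conv_of_real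
        mult.commute)

lemma class_C_const:
  assumes "open \<Omega>" shows "class_C n \<Omega> (\<lambda>z. c)"
proof (induction n arbitrary: c)
  case (Suc n)
  show ?case
    by (rule class_C_SucI_derivative[OF assms _ has_directional_const Suc]) auto
qed auto

lemma class_C_add:
  assumes "open \<Omega>" "class_C n \<Omega> f" "class_C n \<Omega> g"
  shows "class_C n \<Omega> (\<lambda>z. f z + g z)"
  using assms(2,3)
proof (induction n arbitrary: f g)
  case (Suc n)
  show ?case
  proof (rule class_C_SucI_derivative[OF assms(1)])
    show "continuous_on \<Omega> (\<lambda>z. f z + g z)"
      using Suc.prems class_C_continuous_on by (blast intro: continuous_on_add)
    fix d :: complex assume d: "d \<in> {1, \<i>}"
    show "has_directional (\<lambda>z. f z + g z) (directional d f z + directional d g z) d z"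
      if "z \<in> \<Omega>" for z
      using Suc.prems that d by (intro has_directional_add class_C_has_directional)
    show "class_C n \<Omega> (\<lambda>z. directional d f z + directional d g z)"
      using Suc.prems d class_C_Suc_iff by (intro Suc.IH) blast+
  qed
qed (auto intro: continuous_on_add)

lemma class_C_mult:
  assumes "open \<Omega>" "class_C n \<Omega> f" "class_C n \<Omega> g"
  shows "class_C n \<Omega> (\<lambda>z. f z * g z)"
  using assms(2,3)
proof (induction n arbitrary: f g)
  case (Suc n)
  show ?case
  proof (rule class_C_SucI_derivative[OF assms(1)])
    show "continuous_on \<Omega> (\<lambda>z. f z * g z)"
      using Suc.prems class_C_continuous_on by (blast intro: continuous_on_mult)
    fix d :: complex assume d: "d \<in> {1, \<i>}"
    show "has_directional (\<lambda>z. f z * g z) (f z * directional d g z + directional d f z * g z) d z"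
      if "z \<in> \<Omega>" for z
      using Suc.prems that d by (intro has_directional_mult class_C_has_directional)
    \<comment> \<open>The undifferentiated factors are lowered from class \<open>Suc n\<close> to
      class \<open>n\<close>, so that the induction hypothesis covers both products.\<close>
    show "class_C n \<Omega> (\<lambda>z. f z * directional d g z + directional d f z * g z)"
      using Suc.prems d class_C_Suc_iff class_C_SucD
      by (intro class_C_add[OF assms(1)] Suc.IH) blast+
  qed
qed (auto intro: continuous_on_mult)

lemma class_C_cnj:
  assumes "open \<Omega>" shows "class_C n \<Omega> cnj"
proof (cases n)
  case (Suc m)
  show ?thesis unfolding Suc
    by (rule class_C_SucI_derivative[OF assms _ has_directional_cnj class_C_const[OF assms]])
      (intro continuous_intros)
qed (auto intro: continuous_intros)

lemma class_C_power:
  assumes "open \<Omega>" "class_C n \<Omega> f" shows "class_C n \<Omega> (\<lambda>z. f z ^ k)"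
  by (induction k) (auto simp del: class_C.simps intro: class_C_const class_C_mult assms)

lemma class_C_sum:
  assumes "open \<Omega>" "\<And>i. i \<in> I \<Longrightarrow> class_C n \<Omega> (f i)"
  shows "class_C n \<Omega> (\<lambda>z. \<Sum>i\<in>I. f i z)"
  using assms(2)
  by (induction I rule: infinite_finite_induct)
    (auto simp del: class_C.simps intro: class_C_const class_C_add assms(1))

section \<open>Calculus of the operator \<open>dbar\<close>\<close>

lemma class_C_dbar:
  assumes "open \<Omega>" "class_C (Suc n) \<Omega> f" shows "class_C n \<Omega> (dbar f)"
  unfolding dbar_directional[abs_def]
  using assms(2) class_C_Suc_iff
  by (intro class_C_mult class_C_add class_C_const assms(1)) blast+

lemma class_C_dbar_funpow:
  assumes "open \<Omega>" "class_C (n + k) \<Omega> f" shows "class_C n \<Omega> ((dbar ^^ k) f)"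
  using assms(2)
\<comment> \<open>Each \<open>dbar\<close> costs one order of differentiability, so the induction
  hypothesis is used at \<open>Suc n\<close>.\<close>
proof (induction k arbitrary: n)
  case (Suc k)
  then have "class_C (Suc n) \<Omega> ((dbar ^^ k) f)" by (metis add_Suc add_Suc_right)
  then show ?case using class_C_dbar[OF assms(1)] by simp
qed auto

lemma dbar_eqI:
  assumes "has_directional f X 1 z" "has_directional f Y \<i> z"
  shows "dbar f z = 1 / 2 * (X + \<i> * Y)"
  using assms by (simp add: dbar_directional has_directional_imp_eq)

lemma dbar_const: "dbar (\<lambda>z. c) z = 0"
  using dbar_eqI[OF has_directional_const has_directional_const] by simp

text \<open>The two directional derivatives are 1 and \<open>- \<i>\<close>, and
  \<open>1 / 2 * (1 + \<i> * (- \<i>)) = 1\<close>.\<close>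

lemma dbar_cnj: "dbar cnj z = 1"
  using dbar_eqI[OF has_directional_cnj has_directional_cnj] by simp

lemma dbar_add:
  assumes "class_C 1 \<Omega> f" "class_C 1 \<Omega> g" "z \<in> \<Omega>"
  shows "dbar (\<lambda>z. f z + g z) z = dbar f z + dbar g z"
proof -
  note D = class_C_has_directional[OF assms(1)[unfolded One_nat_def] assms(3)]
    class_C_has_directional[OF assms(2)[unfolded One_nat_def] assms(3)]
  have "dbar (\<lambda>z. f z + g z) z = 1 / 2 * (directional 1 f z + directional 1 g z +
      \<i> * (directional \<i> f z + directional \<i> g z))"
    by (intro dbar_eqI has_directional_add D) auto
  then show ?thesis by (simp add: dbar_directional algebra_simps)
qed

text \<open>Both partial derivatives obey the product rule, and \<open>dbar\<close> is a fixed
  linear combination of them.\<close>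

lemma dbar_mult:
  assumes "class_C 1 \<Omega> f" "class_C 1 \<Omega> g" "z \<in> \<Omega>"
  shows "dbar (\<lambda>z. f z * g z) z = f z * dbar g z + dbar f z * g z"
proof -
  note D = class_C_has_directional[OF assms(1)[unfolded One_nat_def] assms(3)]
    class_C_has_directional[OF assms(2)[unfolded One_nat_def] assms(3)]
  have "dbar (\<lambda>z. f z * g z) z =
      1 / 2 * (f z * directional 1 g z + directional 1 f z * g z +
      \<i> * (f z * directional \<i> g z + directional \<i> f z * g z))"
    by (intro dbar_eqI has_directional_mult D) auto
  then show ?thesis by (simp add: dbar_directional algebra_simps add_divide_distrib)
qed

lemma dbar_cmult:
  assumes "open \<Omega>" "class_C 1 \<Omega> f" "z \<in> \<Omega>"
  shows "dbar (\<lambda>z. c * f z) z = c * dbar f z"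
  using dbar_mult[OF class_C_const[OF assms(1)] assms(2,3)] by (simp add: dbar_const)

lemma dbar_sum:
  assumes "open \<Omega>" "\<And>i. i \<in> I \<Longrightarrow> class_C 1 \<Omega> (f i)" "z \<in> \<Omega>"
  shows "dbar (\<lambda>z. \<Sum>i\<in>I. f i z) z = (\<Sum>i\<in>I. dbar (f i) z)"
  using assms(2)
proof (induction I rule: infinite_finite_induct)
  case (insert i I)
  have "dbar (\<lambda>z. f i z + (\<Sum>j\<in>I. f j z)) z = dbar (f i) z + dbar (\<lambda>z. \<Sum>j\<in>I. f j z) z"
    using insert.prems by (intro dbar_add[OF _ _ assms(3)] class_C_sum assms(1)) auto
  then show ?case using insert by simp
qed (auto simp: dbar_const)

section \<open>Powers of the conjugate and the telescoping antiderivative\<close>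

lemma dbar_cnj_power: "dbar (\<lambda>z. cnj z ^ Suc k) z = of_nat (Suc k) * cnj z ^ k"
proof (induction k)
  case (Suc k)
  have "dbar (\<lambda>z. cnj z * cnj z ^ Suc k) z =
      cnj z * dbar (\<lambda>z. cnj z ^ Suc k) z + dbar cnj z * cnj z ^ Suc k"
    by (rule dbar_mult[of UNIV]) (intro class_C_power class_C_cnj open_UNIV UNIV_I)+
  then show ?case using Suc by (simp add: dbar_cnj algebra_simps)
qed (simp add: dbar_cnj)

text \<open>Only \<open>dbar\<close> powers of order below \<open>n\<close> enter \<open>u\<close>,
  and these are still of class 1 because \<open>f\<close> is of class \<open>n\<close>. Class 1 for
  \<open>u\<close> guarantees that the partial derivatives in \<open>dbar u\<close> really
  exist.\<close>

lemma dbar_antiderivative: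
  assumes "open \<Omega>" "polyanalytic_on n \<Omega> f" "z \<in> \<Omega>"
  defines "u \<equiv> \<lambda>z. - (\<Sum>k=1..n. (- 1) ^ k / fact k * cnj z ^ k * (dbar ^^ (k - 1)) f z)"
  shows "class_C 1 \<Omega> u" "dbar u z = f z"
proof -
  \<comment> \<open>The summation index is shifted down by one, which removes the truncated
    subtraction \<open>k - 1\<close>; \<open>c k\<close> absorbs both the shift and the outer minus
    sign.\<close>
  define t where "t k w = cnj w ^ Suc k * (dbar ^^ k) f w" for k w
  define c :: "nat \<Rightarrow> complex" where "c k = - ((- 1) ^ Suc k / fact (Suc k))" for k
  have u: "u = (\<lambda>w. \<Sum>k<n. c k * t k w)"
    by (simp add: u_def c_def t_def fun_eq_iff sum.atLeast1_atMost_eq sum_negf[symmetric]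
        mult.assoc del: fact_Suc power_Suc)
  have g: "class_C 1 \<Omega> ((dbar ^^ k) f)" if "k < n" for k
    using that assms(2) unfolding polyanalytic_on_def
    by (intro class_C_dbar_funpow assms(1) class_C_mono[of "1 + k" n]) auto
  have pow: "class_C 1 \<Omega> (\<lambda>w. cnj w ^ Suc k)" for k
    by (intro class_C_power class_C_cnj assms(1))
  have t: "class_C 1 \<Omega> (t k)" if "k < n" for k
    unfolding t_def by (intro class_C_mult assms(1) pow g that)
  have ct: "class_C 1 \<Omega> (\<lambda>w. c k * t k w)" if "k < n" for k
    by (intro class_C_mult class_C_const assms(1) t that)
  show "class_C 1 \<Omega> u" unfolding u
    by (rule class_C_sum[OF assms(1)]) (use ct in auto)
  \<comment> \<open>The telescoping terms: differentiating \<open>cnj z ^ Suc k\<close> yields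
    \<open>a k\<close> because \<open>c k * of_nat (Suc k) = (- 1) ^ k / fact k\<close>, while
    differentiating the other factor yields \<open>- a (Suc k)\<close>.\<close>
  define a :: "nat \<Rightarrow> complex" where "a k = (- 1) ^ k / fact k * cnj z ^ k * (dbar ^^ k) f z" for k
  have step: "dbar (\<lambda>w. c k * t k w) z = a k - a (Suc k)" if "k < n" for k
  proof -
    have "dbar (t k) z = cnj z ^ Suc k * (dbar ^^ Suc k) f z +
        of_nat (Suc k) * cnj z ^ k * (dbar ^^ k) f z"
      unfolding t_def using dbar_mult[OF pow g[OF that] assms(3)]
      by (simp only: dbar_cnj_power funpow.simps o_apply)
    moreover have "c k * of_nat (Suc k) = (- 1) ^ k / fact k"
      by (simp add: c_def field_simps del: of_nat_Suc)
    ultimately have "c k * dbar (t k) z = c k * (cnj z ^ Suc k * (dbar ^^ Suc k) f z) +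
        (- 1) ^ k / fact k * (cnj z ^ k * (dbar ^^ k) f z)"
      by (metis (no_types, lifting) distrib_left mult.assoc)
    also have "\<dots> = a k - a (Suc k)"
      by (simp add: a_def c_def mult.assoc del: funpow.simps fact_Suc power_Suc)
    finally have "c k * dbar (t k) z = a k - a (Suc k)" .
    then show ?thesis using dbar_cmult[OF assms(1) t[OF that] assms(3)] by simp
  qed
  have "dbar u z = (\<Sum>k<n. dbar (\<lambda>w. c k * t k w) z)"
    unfolding u by (rule dbar_sum[OF assms(1) _ assms(3)]) (use ct in auto)
  also have "\<dots> = (\<Sum>k<n. a k - a (Suc k))"
    by (intro sum.cong) (auto simp: step)
  also have "\<dots> = a 0 - a n"
    by (rule sum_lessThan_telescope')
  \<comment> \<open>\<open>a 0\<close> is \<open>f z\<close>, and \<open>a n\<close> vanishes since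
    it contains the factor \<open>(dbar ^^ n) f z\<close>.\<close>
  also have "\<dots> = f z"
    using assms(2,3) by (simp add: a_def polyanalytic_on_def)
  finally show "dbar u z = f z" .
qed

section \<open>Borel measurability of upper semicontinuous functions\<close>

lemma upper_semicontinuous_borel_measurable:
  fixes p :: "'a::topological_space \<Rightarrow> real"
  assumes "open \<Omega>" "\<And>z a. z \<in> \<Omega> \<Longrightarrow> p z < a \<Longrightarrow> eventually (\<lambda>w. p w < a) (at z within \<Omega>)"
  shows "p \<in> borel_measurable (restrict_space borel \<Omega>)"
proof (rule borel_measurableI_less)
  fix a :: real
  \<comment> \<open>Openness of all strict sublevel sets suffices. The filter at \<open>z\<close>
    sees only a punctured neighbourhood; the centre itself is covered by
    \<open>p z < a\<close>.\<close>
  have "open {z \<in> \<Omega>. p z < a}"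
  proof (subst open_subopen, intro ballI)
    fix z assume z: "z \<in> {z \<in> \<Omega>. p z < a}"
    then have "eventually (\<lambda>w. p w < a) (at z)"
      using assms at_within_open by (metis (mono_tags, lifting) mem_Collect_eq)
    then obtain S where "open S" "z \<in> S" "\<And>w. w \<in> S \<Longrightarrow> w \<noteq> z \<Longrightarrow> p w < a"
      unfolding eventually_at_topological by blast
    with z assms(1) show "\<exists>T. open T \<and> z \<in> T \<and> T \<subseteq> {z \<in> \<Omega>. p z < a}"
      by (intro exI[of _ "S \<inter> \<Omega>"]) auto
  qed
  then show "{z \<in> space (restrict_space borel \<Omega>). p z < a} \<in> sets (restrict_space borel \<Omega>)"
    using assms(1) by (auto simp: sets_restrict_space space_restrict_space image_iff
        intro!: bexI[of _ "{z \<in> \<Omega>. p z < a}"])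
qed

section \<open>The pointwise weighted bound\<close>

lemma sum_squared_le_card:
  fixes f :: "'i \<Rightarrow> real"
  shows "(\<Sum>i\<in>I. f i)\<^sup>2 \<le> of_nat (card I) * (\<Sum>i\<in>I. (f i)\<^sup>2)"
  using Cauchy_Schwarz_ineq_sum[of f "\<lambda>_. 1" I] by (simp add: mult.commute)

text \<open>The factor \<open>n\<close> is the number of summands in Cauchy-Schwarz. The weight
  absorbs each coefficient because \<open>k \<le> 2 * n\<close>, the base
  \<open>1 + (cmod z)\<^sup>2\<close> is at least 1, and \<open>fact k \<ge> 1\<close>. The numbers
  \<open>g k\<close> are arbitrary, so the bound is purely algebraic.\<close>

lemma antiderivative_bound:
  fixes z :: complex and g :: "nat \<Rightarrow> complex"
  shows "(cmod (\<Sum>k=1..n. (- 1) ^ k / fact k * cnj z ^ k * g k))\<^sup>2 / (1 + (cmod z)\<^sup>2) ^ (2 * n)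
    \<le> of_nat n * (\<Sum>k=1..n. (cmod (g k))\<^sup>2)"
proof -
  let ?W = "(1 + (cmod z)\<^sup>2) ^ (2 * n)"
  have bound: "(cmod ((- 1) ^ k / fact k * cnj z ^ k * g k))\<^sup>2 \<le> ?W * (cmod (g k))\<^sup>2"
    if "k \<in> {1..n}" for k
  proof -
    have "((cmod z)\<^sup>2) ^ k \<le> (1 + (cmod z)\<^sup>2) ^ k"
      by (intro power_mono) auto
    also have "\<dots> \<le> ?W"
      using that by (intro power_increasing) auto
    finally have z: "((cmod z)\<^sup>2) ^ k \<le> ?W" .
    have "((cmod z)\<^sup>2) ^ k / (fact k)\<^sup>2 \<le> ((cmod z)\<^sup>2) ^ k / 1"
      by (intro divide_left_mono) (auto simp: fact_ge_1)
    with z have "((cmod z)\<^sup>2) ^ k / (fact k)\<^sup>2 \<le> ?W" by simp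
    then have "((cmod z)\<^sup>2) ^ k / (fact k)\<^sup>2 * (cmod (g k))\<^sup>2 \<le> ?W * (cmod (g k))\<^sup>2"
      by (intro mult_right_mono) auto
    moreover have "(cmod ((- 1) ^ k / fact k * cnj z ^ k * g k))\<^sup>2 =
        ((cmod z)\<^sup>2) ^ k / (fact k)\<^sup>2 * (cmod (g k))\<^sup>2"
      by (simp add: norm_mult norm_divide norm_power power_mult_distrib power_divide
          flip: power_mult add: mult.commute)
    ultimately show ?thesis by simp
  qed
  have "(cmod (\<Sum>k=1..n. (- 1) ^ k / fact k * cnj z ^ k * g k))\<^sup>2
      \<le> (\<Sum>k=1..n. cmod ((- 1) ^ k / fact k * cnj z ^ k * g k))\<^sup>2"
    by (intro power_mono norm_sum) auto
  also have "\<dots> \<le> of_nat n * (\<Sum>k=1..n. (cmod ((- 1) ^ k / fact k * cnj z ^ k * g k))\<^sup>2)"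
    using sum_squared_le_card[of _ "{1..n}"] by simp
  also have "\<dots> \<le> of_nat n * (\<Sum>k=1..n. ?W * (cmod (g k))\<^sup>2)"
    by (intro mult_left_mono sum_mono bound) auto
  also have "\<dots> = of_nat n * (\<Sum>k=1..n. (cmod (g k))\<^sup>2) * ?W"
    by (simp add: mult_ac flip: sum_distrib_left sum_distrib_right)
  finally show ?thesis
    by (subst pos_divide_le_eq) (auto intro!: zero_less_power add_pos_nonneg)
qed

section \<open>The equation for \<open>u\<close> and the integrated estimate\<close>

theorem proposition4p8:
  fixes \<Omega> :: "complex set" and p :: "complex \<Rightarrow> real" and f u :: "complex \<Rightarrow> complex" and n :: nat
  assumes "open \<Omega>"
    and "subharmonic_on \<Omega> p"
    and "\<forall>z\<in>\<Omega>. 0 \<le> p z"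
    and "\<exists>M>0. \<forall>z\<in>\<Omega>. ln (1 + (cmod z)\<^sup>2) \<le> M * p z"
    and "\<exists>C>0. \<exists>D>0. \<forall>z\<in>\<Omega>. \<forall>w\<in>\<Omega>. cmod (z - w) \<le> 1 \<longrightarrow> p z \<le> C * p w + D"
    and "n \<ge> 1"
    and "f \<in> weighted_polyanalytic n p \<Omega>"
    and "u = (\<lambda>z. - (\<Sum>k=1..n. (- 1) ^ k / fact k * cnj z ^ k * (dbar ^^ (k - 1)) f z))"
  shows "class_C 1 \<Omega> u \<and> (\<forall>z\<in>\<Omega>. dbar u z = f z) \<and>
    (\<integral>\<^sup>+z\<in>\<Omega>. ennreal ((cmod (u z))\<^sup>2 / (1 + (cmod z)\<^sup>2) ^ (2 * n) * exp (- p z)) \<partial>lebesgue)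
      \<le> of_nat n * (\<Sum>k=1..n. \<integral>\<^sup>+z\<in>\<Omega>. ennreal ((cmod ((dbar ^^ (k - 1)) f z))\<^sup>2 * exp (- p z)) \<partial>lebesgue) \<and>
    of_nat n * (\<Sum>k=1..n. \<integral>\<^sup>+z\<in>\<Omega>. ennreal ((cmod ((dbar ^^ (k - 1)) f z))\<^sup>2 * exp (- p z)) \<partial>lebesgue) < \<infinity>"
proof -
  define h where "h k z = (cmod ((dbar ^^ (k - 1)) f z))\<^sup>2 * exp (- p z)" for k z
  have h_nonneg: "0 \<le> h k z" for k z
    by (simp add: h_def)
  have poly: "polyanalytic_on n \<Omega> f"
    using assms(7) by (simp add: weighted_polyanalytic_def)
  \<comment> \<open>For \<open>k\<close> from 1 to \<open>n\<close>, the order \<open>k - 1\<close>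
    runs through exactly the orders below \<open>n\<close> for which integrability is given.\<close>
  have fin: "(\<integral>\<^sup>+z\<in>\<Omega>. ennreal (h k z) \<partial>lebesgue) < \<infinity>" if "k \<in> {1..n}" for k
    using assms(7) that by (auto simp: weighted_polyanalytic_def h_def)
  have u: "class_C 1 \<Omega> u" "dbar u z = f z" if "z \<in> \<Omega>" for z
    using dbar_antiderivative[OF assms(1) poly that] unfolding assms(8) by blast+
  have "class_C 1 \<Omega> u"
    \<comment> \<open>The regularity of \<open>u\<close> was obtained from a point of
      \<open>\<Omega>\<close>; on the empty set it is vacuous.\<close>
    using u(1) by (cases "\<Omega> = {}") auto
  have "p \<in> borel_measurable (restrict_space borel \<Omega>)"
    using assms(2) unfolding subharmonic_on_def
    by (intro upper_semicontinuous_borel_measurable assms(1)) blast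
  moreover have "(dbar ^^ (k - 1)) f \<in> borel_measurable (restrict_space borel \<Omega>)"
    if "k \<in> {1..n}" for k
  proof -
    have "class_C 0 \<Omega> ((dbar ^^ (k - 1)) f)"
      using that poly unfolding polyanalytic_on_def
      by (intro class_C_dbar_funpow assms(1) class_C_mono[of "0 + (k - 1)" n]) auto
    then show ?thesis
      by (intro borel_measurable_continuous_on_restrict) (auto simp: class_C_continuous_on)
  qed
  ultimately have "h k \<in> borel_measurable (restrict_space borel \<Omega>)" if "k \<in> {1..n}" for k
    using that unfolding h_def by measurable
  then have "(\<lambda>z. ennreal (h k z)) \<in> borel_measurable (restrict_space borel \<Omega>)"
    if "k \<in> {1..n}" for k
    using that by measurable
  \<comment> \<open>Measurability is known only on \<open>\<Omega>\<close>; extension by 0 keeps it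
    because the open set \<open>\<Omega>\<close> is Borel. Passing to the completion then gives
    Lebesgue measurability.\<close>
  then have "(\<lambda>z. ennreal (h k z) * indicator \<Omega> z) \<in> borel_measurable lborel"
    if "k \<in> {1..n}" for k
    using that assms(1) by (subst (asm) borel_measurable_restrict_space_iff_ennreal) auto
  then have meas: "(\<lambda>z. ennreal (h k z) * indicator \<Omega> z) \<in> borel_measurable lebesgue"
    if "k \<in> {1..n}" for k
    using that by (intro measurable_completion) auto
  have "(\<integral>\<^sup>+z\<in>\<Omega>. ennreal ((cmod (u z))\<^sup>2 / (1 + (cmod z)\<^sup>2) ^ (2 * n) * exp (- p z)) \<partial>lebesgue)
      \<le> (\<integral>\<^sup>+z. of_nat n * (\<Sum>k=1..n. ennreal (h k z) * indicator \<Omega> z) \<partial>lebesgue)"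
  proof (rule nn_integral_mono)
    fix z :: complex
    have "(cmod (u z))\<^sup>2 / (1 + (cmod z)\<^sup>2) ^ (2 * n) * exp (- p z)
        \<le> of_nat n * (\<Sum>k=1..n. (cmod ((dbar ^^ (k - 1)) f z))\<^sup>2) * exp (- p z)"
      unfolding assms(8) norm_minus_cancel by (intro mult_right_mono antiderivative_bound) auto
    also have "\<dots> = of_nat n * (\<Sum>k=1..n. h k z)"
      by (simp add: h_def sum_distrib_right)
    finally have "ennreal ((cmod (u z))\<^sup>2 / (1 + (cmod z)\<^sup>2) ^ (2 * n) * exp (- p z))
        \<le> ennreal (of_nat n * (\<Sum>k=1..n. h k z))"
      by (rule ennreal_leI)
    \<comment> \<open>\<open>ennreal\<close> sends negative reals to 0, so distributing it over the
      sum relies on \<open>h_nonneg\<close>.\<close>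
    also have "\<dots> = of_nat n * (\<Sum>k=1..n. ennreal (h k z))"
      using h_nonneg by (simp add: ennreal_mult sum_nonneg ennreal_of_nat_eq_real_of_nat)
    finally show "ennreal ((cmod (u z))\<^sup>2 / (1 + (cmod z)\<^sup>2) ^ (2 * n) * exp (- p z)) * indicator \<Omega> z
        \<le> of_nat n * (\<Sum>k=1..n. ennreal (h k z) * indicator \<Omega> z)"
      by (auto simp: indicator_def)
  qed
  also have "\<dots> = of_nat n * (\<Sum>k=1..n. \<integral>\<^sup>+z\<in>\<Omega>. ennreal (h k z) \<partial>lebesgue)"
    \<comment> \<open>Measurability of the summands allows first the constant and then the finite
      sum to be moved outside the integral.\<close>
    by (subst nn_integral_cmult, intro borel_measurable_sum meas, assumption)
      (subst nn_integral_sum, use meas in auto)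
  finally have est: "(\<integral>\<^sup>+z\<in>\<Omega>. ennreal ((cmod (u z))\<^sup>2 / (1 + (cmod z)\<^sup>2) ^ (2 * n) * exp (- p z)) \<partial>lebesgue)
      \<le> of_nat n * (\<Sum>k=1..n. \<integral>\<^sup>+z\<in>\<Omega>. ennreal (h k z) \<partial>lebesgue)" .
  have "(\<Sum>k=1..n. \<integral>\<^sup>+z\<in>\<Omega>. ennreal (h k z) \<partial>lebesgue) < \<infinity>"
    using fin by (simp add: less_top ennreal_sum_less_top)
  then have "of_nat n * (\<Sum>k=1..n. \<integral>\<^sup>+z\<in>\<Omega>. ennreal (h k z) \<partial>lebesgue) < \<infinity>"
    by (auto simp: ennreal_mult_less_top of_nat_less_top)
  with est \<open>class_C 1 \<Omega> u\<close> u(2) show ?thesis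
    unfolding h_def by blast
qed

end
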